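(* Let $F_1$ and $F_2$ be finite subsets of $\mathbb{Z}^2$ such that $F_1$ is uniquely determined by its row and column sums and $|F_1| = |F_2|$. Let $2\alpha = \sum_{j\in\mathbb{Z}} |c_j^{(1)} - c_j^{(2)}| + \sum_{i\in\mathbb{Z}} |r_i^{(1)} - r_i^{(2)}|$, let $p = |F_1 \cap F_2|$, and write $\beta = \sqrt{\alpha}(\alpha+1)$. Then \[ |F_1| \le p + \sqrt{\frac{\alpha}{4}\left(\beta + \sqrt{\beta(\alpha-1) + 4(\alpha+1)p + \beta^2} + \frac{\alpha-1}{2}\right)^2 - \frac{(\alpha-1)^2\alpha}{16}}. \]
   Context: For $i \in \mathbb{Z}$, row $i$ is $\{(x,y)\in\mathbb{Z}^2 : x = i\}$ and for $j\in\mathbb{Z}$, column $j$ is $\{(x,y)\in\mathbb{Z}^2: y=j\}$. For $h\in\{1,2\}$, $r_i^{(h)}$ is the number of points of $F_h$ in row $i$ and $c_j^{(h)}$ the number of points of $F_h$ in column $j$. $F_1$ is uniquely determined by its row and column sums if no finite subset of $\mathbb{Z}^2$ other than $F_1$ has the same row sums and column sums. The total error in the line sums is always even, hence written $2\alpha$ with $\alpha$ a nonnegative integer. *)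

theory Defs
  imports Complex_Main "HOL-Library.Groups_Big_Fun"
begin

definition row :: "int \<Rightarrow> (int \<times> int) set" where
  "row i = {(x, y). x = i}"

definition column :: "int \<Rightarrow> (int \<times> int) set" where
  "column j = {(x, y). y = j}"

definition row_sum :: "(int \<times> int) set \<Rightarrow> int \<Rightarrow> nat" where
  "row_sum F i = card (F \<inter> row i)"

definition column_sum :: "(int \<times> int) set \<Rightarrow> int \<Rightarrow> nat" where
  "column_sum F j = card (F \<inter> column j)"

definition uniquely_determined :: "(int \<times> int) set \<Rightarrow> bool" where
  "uniquely_determined F \<longleftrightarrow>
     (\<forall>G. finite G \<and> (\<forall>i. row_sum G i = row_sum F i) \<and>
          (\<forall>j. column_sum G j = column_sum F j) \<longrightarrow> G = F)"

text \<open>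
  For finite sets only finitely many summands are nonzero
  (see \<open>finite_column_error\<close> and \<open>finite_row_error\<close> below), so \<^const>\<open>Sum_any\<close> is the
  genuine sum over all integers. The counts are cast to \<^typ>\<open>int\<close> because subtraction on
  \<^typ>\<open>nat\<close> truncates.
\<close>

definition line_sum_error :: "(int \<times> int) set \<Rightarrow> (int \<times> int) set \<Rightarrow> int" where
  "line_sum_error F G =
     Sum_any (\<lambda>j. \<bar>int (column_sum F j) - int (column_sum G j)\<bar>) +
     Sum_any (\<lambda>i. \<bar>int (row_sum F i) - int (row_sum G i)\<bar>)"

lemma column_sum_eq_0: "j \<notin> snd ` F \<Longrightarrow> column_sum F j = 0"
proof -
  assume "j \<notin> snd ` F"
  then have "F \<inter> column j = {}" by (force simp: column_def)
  then show ?thesis by (simp add: column_sum_def)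
qed

lemma row_sum_eq_0: "i \<notin> fst ` F \<Longrightarrow> row_sum F i = 0"
proof -
  assume "i \<notin> fst ` F"
  then have "F \<inter> row i = {}" by (force simp: row_def)
  then show ?thesis by (simp add: row_sum_def)
qed

lemma column_error_support:
  "{j. \<bar>int (column_sum F j) - int (column_sum G j)\<bar> \<noteq> 0} \<subseteq> snd ` (F \<union> G)"
proof (rule subsetI, rule ccontr)
  fix j
  assume "j \<in> {j. \<bar>int (column_sum F j) - int (column_sum G j)\<bar> \<noteq> 0}" "j \<notin> snd ` (F \<union> G)"
  then show False
    using column_sum_eq_0[of j F] column_sum_eq_0[of j G] by (auto simp: image_Un)
qed

lemma row_error_support:
  "{i. \<bar>int (row_sum F i) - int (row_sum G i)\<bar> \<noteq> 0} \<subseteq> fst ` (F \<union> G)"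
proof (rule subsetI, rule ccontr)
  fix i
  assume "i \<in> {i. \<bar>int (row_sum F i) - int (row_sum G i)\<bar> \<noteq> 0}" "i \<notin> fst ` (F \<union> G)"
  then show False
    using row_sum_eq_0[of i F] row_sum_eq_0[of i G] by (auto simp: image_Un)
qed

lemma finite_column_error:
  assumes "finite F" "finite G"
  shows "finite {j. \<bar>int (column_sum F j) - int (column_sum G j)\<bar> \<noteq> 0}"
  using assms by (intro finite_subset[OF column_error_support]) auto

lemma finite_row_error:
  assumes "finite F" "finite G"
  shows "finite {i. \<bar>int (row_sum F i) - int (row_sum G i)\<bar> \<noteq> 0}"
  using assms by (intro finite_subset[OF row_error_support]) auto

lemma sum_column_sum:
  assumes "finite F" "finite J" "snd ` F \<subseteq> J"
  shows "(\<Sum>j\<in>J. column_sum F j) = card F"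
proof -
  have "F = (\<Union>j\<in>J. F \<inter> column j)"
    using assms(3) by (force simp: column_def)
  then have "card F = card (\<Union>j\<in>J. F \<inter> column j)" by simp
  also have "\<dots> = (\<Sum>j\<in>J. card (F \<inter> column j))"
    using assms by (intro card_UN_disjoint) (auto simp: column_def)
  finally show ?thesis by (simp add: column_sum_def)
qed

lemma sum_row_sum:
  assumes "finite F" "finite I" "fst ` F \<subseteq> I"
  shows "(\<Sum>i\<in>I. row_sum F i) = card F"
proof -
  have "F = (\<Union>i\<in>I. F \<inter> row i)"
    using assms(3) by (force simp: row_def)
  then have "card F = card (\<Union>i\<in>I. F \<inter> row i)" by simp
  also have "\<dots> = (\<Sum>i\<in>I. card (F \<inter> row i))"
    using assms by (intro card_UN_disjoint) (auto simp: row_def)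
  finally show ?thesis by (simp add: row_sum_def)
qed

lemma even_sum_abs_iff:
  fixes f :: "'a \<Rightarrow> int"
  shows "even (\<Sum>x\<in>A. \<bar>f x\<bar>) \<longleftrightarrow> even (\<Sum>x\<in>A. f x)"
  by (induction A rule: infinite_finite_induct) auto

lemma line_sum_error_even:
  assumes "finite F" "finite G" "card F = card G"
  obtains \<alpha> :: nat where "2 * int \<alpha> = line_sum_error F G"
proof -
  let ?J = "snd ` (F \<union> G)" and ?I = "fst ` (F \<union> G)"
  have fin: "finite ?J" "finite ?I" using assms by auto
  have c: "(\<Sum>j\<in>?J. int (column_sum F j) - int (column_sum G j)) = 0"
    using sum_column_sum[of F ?J] sum_column_sum[of G ?J] assms fin
    by (simp add: sum_subtractf image_Un flip: of_nat_sum)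
  have r: "(\<Sum>i\<in>?I. int (row_sum F i) - int (row_sum G i)) = 0"
    using sum_row_sum[of F ?I] sum_row_sum[of G ?I] assms fin
    by (simp add: sum_subtractf image_Un flip: of_nat_sum)
  have e: "line_sum_error F G =
      (\<Sum>j\<in>?J. \<bar>int (column_sum F j) - int (column_sum G j)\<bar>) +
      (\<Sum>i\<in>?I. \<bar>int (row_sum F i) - int (row_sum G i)\<bar>)"
    unfolding line_sum_error_def
    using Sum_any.expand_superset[OF fin(1) column_error_support[of F G]]
      Sum_any.expand_superset[OF fin(2) row_error_support[of F G]] by simp
  have "even (line_sum_error F G)"
    unfolding e even_add even_sum_abs_iff c r by simp
  moreover have "line_sum_error F G \<ge> 0"
    unfolding e by (intro add_nonneg_nonneg sum_nonneg) auto
  ultimately have "2 * int (nat (line_sum_error F G div 2)) = line_sum_error F G"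
    by simp
  then show thesis by (rule that)
qed

end

theory Submission
  imports Defs
begin

text \<open>
  The rows of a uniquely determined set \<open>F\<close> are nested, so \<open>F\<close> is a Young diagram up to
  permutations. Whenever a rectangle \<open>I \<times> J\<close> lies in \<open>F\<close> and \<open>F\<close> misses the complementary
  rectangle, at most \<open>\<alpha>\<close> points of \<open>D = F - G\<close> lie in \<open>I \<times> J\<close>. Stabbing \<open>D\<close> greedily by such
  corner rectangles cuts the columns into slices of sizes \<open>x\<^sub>s\<close> and the rows into slices of sizes
  \<open>y\<^sub>s\<close>. Let \<open>m\<^sub>s\<close> be the number of points of \<open>D\<close> in the \<open>s\<close>-th diagonal block.
  Points of \<open>D\<close> off the diagonal blocks lie in several of the rectangles, which gives
  \<open>2 |D| \<le> \<Sum>\<^sub>s (\<alpha> + m\<^sub>s)\<close> with \<open>m\<^sub>s \<le> min \<alpha> (x\<^sub>s y\<^sub>s)\<close>, while \<open>|F| \<ge> \<Sum>\<^bsub>s \<le> t\<^esub> x\<^sub>s y\<^sub>t\<close>. A quadratic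
  form inequality turns these two bounds into \<open>|D|\<^sup>2 \<le> \<alpha> (\<alpha> + 1) |F|\<close>, which implies the claim
  because \<open>|F| = |D| + p\<close>.
\<close>

section \<open>Switching and corner rectangles\<close>

text \<open>If both inclusions fail, two rows and two columns span a rectangle with one diagonal in
  \<open>F\<close> and the other outside; exchanging the diagonals keeps all line sums.\<close>

lemma uniquely_determined_nested:
  assumes "finite F" "uniquely_determined F"
  shows "F `` {i} \<subseteq> F `` {i'} \<or> F `` {i'} \<subseteq> F `` {i}"
proof (rule ccontr)
  assume "\<not> ?thesis"
  then obtain j j' where j: "(i, j) \<in> F" "(i', j) \<notin> F" "(i', j') \<in> F" "(i, j') \<notin> F"
    by auto
  then have ne: "i \<noteq> i'" "j \<noteq> j'" by auto
  define G where "G = (F - {(i, j), (i', j')}) \<union> {(i, j'), (i', j)}"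
  have move: "card (insert b (A - {a})) = card A"
    if "finite A" "a \<in> A" "b \<notin> A" for a b and A :: "(int \<times> int) set"
    using that by (metis card.remove card_insert_disjoint finite_Diff Diff_iff)
  have "row_sum G r = row_sum F r" for r
  proof -
    have "G \<inter> row r = (if r = i then insert (i, j') (F \<inter> row r - {(i, j)})
        else if r = i' then insert (i', j) (F \<inter> row r - {(i', j')}) else F \<inter> row r)"
      using ne by (auto simp: G_def row_def)
    moreover have "card (insert (i, j') (F \<inter> row i - {(i, j)})) = card (F \<inter> row i)"
      "card (insert (i', j) (F \<inter> row i' - {(i', j')})) = card (F \<inter> row i')"
      by (rule move; use j assms(1) in \<open>simp add: row_def\<close>)+
    ultimately show ?thesis
      unfolding row_sum_def by simp
  qed
  moreover have "column_sum G c = column_sum F c" for c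
  proof -
    have "G \<inter> column c = (if c = j then insert (i', j) (F \<inter> column c - {(i, j)})
        else if c = j' then insert (i, j') (F \<inter> column c - {(i', j')}) else F \<inter> column c)"
      using ne by (auto simp: G_def column_def)
    moreover have "card (insert (i', j) (F \<inter> column j - {(i, j)})) = card (F \<inter> column j)"
      "card (insert (i, j') (F \<inter> column j' - {(i', j')})) = card (F \<inter> column j')"
      by (rule move; use j assms(1) in \<open>simp add: column_def\<close>)+
    ultimately show ?thesis
      unfolding column_sum_def by simp
  qed
  moreover have "finite G" using assms(1) by (simp add: G_def)
  ultimately have "G = F"
    using assms(2) unfolding uniquely_determined_def by blast
  then show False using j by (auto simp: G_def)
qed

lemma sum_row_sum_Int:
  assumes "finite F" "finite S" "fst ` F \<subseteq> S"
  shows "(\<Sum>i\<in>S \<inter> I. row_sum F i) = card (F \<inter> I \<times> UNIV)"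
proof -
  have "(\<Sum>i\<in>S \<inter> I. row_sum F i) = (\<Sum>i\<in>S \<inter> I. row_sum (F \<inter> I \<times> UNIV) i)"
    unfolding row_sum_def by (intro sum.cong arg_cong[of _ _ card]) (auto simp: row_def)
  also have "\<dots> = card (F \<inter> I \<times> UNIV)"
    using assms by (intro sum_row_sum) auto
  finally show ?thesis .
qed

lemma sum_column_sum_Int:
  assumes "finite F" "finite S" "snd ` F \<subseteq> S"
  shows "(\<Sum>j\<in>S \<inter> J. column_sum F j) = card (F \<inter> UNIV \<times> J)"
proof -
  have "(\<Sum>j\<in>S \<inter> J. column_sum F j) = (\<Sum>j\<in>S \<inter> J. column_sum (F \<inter> UNIV \<times> J) j)"
    unfolding column_sum_def by (intro sum.cong arg_cong[of _ _ card]) (auto simp: column_def)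
  also have "\<dots> = card (F \<inter> UNIV \<times> J)"
    using assms by (intro sum_column_sum) auto
  finally show ?thesis .
qed

text \<open>The sums over \<open>S \<inter> I\<close> and \<open>S - I\<close> are opposite, so both
  parts contribute the same absolute value.\<close>

lemma sum_abs_ge_twice:
  fixes h :: "'a \<Rightarrow> int"
  assumes "finite S" "sum h S = 0"
  shows "2 * \<bar>sum h (S \<inter> I)\<bar> \<le> (\<Sum>i\<in>S. \<bar>h i\<bar>)"
proof -
  have split: "sum k S = sum k (S \<inter> I) + sum k (S - I)" for k :: "'a \<Rightarrow> int"
    by (metis assms(1) sum.Int_Diff)
  have "\<bar>sum h (S \<inter> I)\<bar> \<le> (\<Sum>i\<in>S \<inter> I. \<bar>h i\<bar>)" "\<bar>sum h (S - I)\<bar> \<le> (\<Sum>i\<in>S - I. \<bar>h i\<bar>)"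
    by (rule sum_abs)+
  then show ?thesis using split[of h] split[of "\<lambda>i. \<bar>h i\<bar>"] assms(2) by linarith
qed

text \<open>The error is at least twice the row surplus of \<open>F\<close> over \<open>I\<close> plus twice the column deficit
  over \<open>- J\<close>; in that sum the points of \<open>I \<times> - J\<close> cancel.\<close>

lemma card_diff_in_rectangle_le:
  assumes fin: "finite F" "finite G" and card_eq: "card F = card G"
    and err: "2 * int \<alpha> = line_sum_error F G"
    and inside: "I \<times> J \<subseteq> F" and outside: "F \<inter> (- I) \<times> (- J) = {}"
  shows "card ((F - G) \<inter> I \<times> J) \<le> \<alpha>"
proof -
  define A B where "A = fst ` (F \<union> G)" and "B = snd ` (F \<union> G)"
  have AB: "finite A" "finite B" "fst ` F \<subseteq> A" "fst ` G \<subseteq> A" "snd ` F \<subseteq> B" "snd ` G \<subseteq> B"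
    using fin by (auto simp: A_def B_def)
  define r where "r i = int (row_sum F i) - int (row_sum G i)" for i
  define c where "c j = int (column_sum F j) - int (column_sum G j)" for j
  have e: "line_sum_error F G = (\<Sum>j\<in>B. \<bar>c j\<bar>) + (\<Sum>i\<in>A. \<bar>r i\<bar>)"
    unfolding line_sum_error_def r_def c_def
    using Sum_any.expand_superset[OF AB(2) column_error_support[of F G, folded B_def]]
      Sum_any.expand_superset[OF AB(1) row_error_support[of F G, folded A_def]] by simp
  have r_sum: "sum r (A \<inter> K) = int (card (F \<inter> K \<times> UNIV)) - int (card (G \<inter> K \<times> UNIV))" for K
    unfolding r_def sum_subtractf
    using sum_row_sum_Int[of F A K] sum_row_sum_Int[of G A K] AB fin by (simp flip: of_nat_sum)
  have c_sum: "sum c (B \<inter> K) = int (card (F \<inter> UNIV \<times> K)) - int (card (G \<inter> UNIV \<times> K))" for K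
    unfolding c_def sum_subtractf
    using sum_column_sum_Int[of F B K] sum_column_sum_Int[of G B K] AB fin
    by (simp flip: of_nat_sum)
  have "sum r A = 0" "sum c B = 0"
    using r_sum[of UNIV] c_sum[of UNIV] card_eq by simp_all
  then have *: "sum r (A \<inter> I) - sum c (B \<inter> - J) \<le> int \<alpha>"
    using sum_abs_ge_twice[of A r I] sum_abs_ge_twice[of B c "- J"] AB err e by linarith
  have row_split: "card (E \<inter> I \<times> UNIV) = card (E \<inter> I \<times> J) + card (E \<inter> I \<times> - J)"
    if "finite E" for E :: "(int \<times> int) set"
    using that by (subst card_Un_disjoint[symmetric]) (auto intro!: arg_cong[of _ _ card])
  have col_split: "card (E \<inter> UNIV \<times> - J) = card (E \<inter> I \<times> - J) + card (E \<inter> (- I) \<times> (- J))"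
    if "finite E" for E :: "(int \<times> int) set"
    using that by (subst card_Un_disjoint[symmetric]) (auto intro!: arg_cong[of _ _ card])
  have "card (F \<inter> I \<times> J) = card ((F - G) \<inter> I \<times> J) + card (G \<inter> I \<times> J)"
    using fin inside by (subst card_Un_disjoint[symmetric]) (auto intro!: arg_cong[of _ _ card])
  \<comment> \<open>After cancellation the left side of \<open>*\<close> is \<open>card ((F - G)
    \<inter> I \<times> J) + card (G \<inter> (- I) \<times> (- J))\<close>.\<close>
  then show ?thesis
    using * row_split[OF fin(1)] row_split[OF fin(2)] col_split[OF fin(1)] col_split[OF fin(2)]
      outside unfolding r_sum c_sum by simp
qed

section \<open>Greedy stabbing of nested rows\<close>

text \<open>The columns are exhausted greedily: the next set is the smallest row that still meets a
  point of \<open>D\<close> outside the current set.\<close>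

lemma greedy_chain:
  fixes R :: "'a \<Rightarrow> 'b set"
  assumes "finite D" and "\<And>i. finite (R i)"
    and nested: "\<And>i i'. R i \<subseteq> R i' \<or> R i' \<subseteq> R i"
    and sub: "\<And>i j. (i, j) \<in> D \<Longrightarrow> j \<in> R i"
    and "\<And>i j. (i, j) \<in> D \<Longrightarrow> j \<notin> C \<Longrightarrow> C \<subseteq> R i"
  obtains k :: nat and J where "J 0 = C"
    and "\<And>s. s < k \<Longrightarrow> J s \<subset> J (Suc s)"
    and "\<And>s. s < k \<Longrightarrow> \<exists>i. J (Suc s) = R i"
    and "\<And>s i j. s < k \<Longrightarrow> (i, j) \<in> D \<Longrightarrow> j \<notin> J s \<Longrightarrow> J (Suc s) \<subseteq> R i"
    and "\<And>i j. (i, j) \<in> D \<Longrightarrow> j \<in> J k"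
proof -
  define chain where "chain C k J \<longleftrightarrow> J 0 = C \<and> (\<forall>s<k. J s \<subset> J (Suc s)) \<and>
      (\<forall>s<k. \<exists>i. J (Suc s) = R i) \<and>
      (\<forall>s<k. \<forall>i j. (i, j) \<in> D \<longrightarrow> j \<notin> J s \<longrightarrow> J (Suc s) \<subseteq> R i) \<and>
      (\<forall>i j. (i, j) \<in> D \<longrightarrow> j \<in> J k)" for C and k :: nat and J
  have "\<exists>k J. chain C k J"
    using assms(5)
  \<comment> \<open>The start set varies in the induction, since the tail of the chain starts from
    the row just chosen.\<close>
  proof (induction "card {(i, j) \<in> D. j \<notin> C}" arbitrary: C rule: less_induct)
    case less
    let ?E = "{(i, j) \<in> D. j \<notin> C}"
    show ?case
    proof (cases "?E = {}")
      case True
      then show ?thesis by (intro exI[of _ 0] exI[of _ "\<lambda>_. C"]) (auto simp: chain_def)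
    next
      case False
      then obtain q where q: "q \<in> ?E" "\<And>q'. q' \<in> ?E \<Longrightarrow> card (R (fst q)) \<le> card (R (fst q'))"
        using ex_has_least_nat[of "\<lambda>q. q \<in> ?E" _ "\<lambda>q. card (R (fst q))"] by blast
      obtain i j where ij: "q = (i, j)" by fastforce
      have D: "(i, j) \<in> D" "j \<notin> C" using q(1) ij by auto
      have C: "C \<subset> R i" using less.prems[OF D] D sub by blast
      \<comment> \<open>For nested finite sets cardinality decides inclusion.\<close>
      have min: "R i \<subseteq> R i'" if "(i', j') \<in> D" "j' \<notin> C" for i' j'
      proof -
        have "card (R i) \<le> card (R i')" using q(2)[of "(i', j')"] that ij by auto
        then show ?thesis using nested[of i i'] card_seteq[OF assms(2)[of i], of "R i'"] by auto
      qed
      have "{(i', j') \<in> D. j' \<notin> R i} \<subset> ?E" using C D sub by blast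
      moreover have "finite ?E" by (rule finite_subset[OF _ assms(1)]) auto
      ultimately have less_card: "card {(i', j') \<in> D. j' \<notin> R i} < card ?E"
        by (intro psubset_card_mono)
      \<comment> \<open>The hypothesis on \<open>C\<close>, now for the start set
        \<open>R i\<close>: a row with a point outside \<open>R i\<close> is not contained in
        it.\<close>
      have "R i \<subseteq> R i'" if "(i', j') \<in> D" "j' \<notin> R i" for i' j'
        using that nested[of i i'] sub by blast
      then obtain k J where J: "chain (R i) k J"
        using less.hyps[OF less_card] by blast
      have "chain C (Suc k) (case_nat C J)"
        unfolding chain_def
      proof (intro conjI)
        show "\<forall>s<Suc k. case_nat C J s \<subset> case_nat C J (Suc s)"
          using J C by (auto simp: chain_def split: nat.split)
        show "\<forall>s<Suc k. \<exists>i. case_nat C J (Suc s) = R i"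
          using J by (auto simp: chain_def less_Suc_eq_0_disj)
        show "\<forall>s<Suc k. \<forall>i j. (i, j) \<in> D \<longrightarrow> j \<notin> case_nat C J s \<longrightarrow> case_nat C J (Suc s) \<subseteq> R i"
          using J min by (simp add: chain_def split: nat.split)
      qed (use J in \<open>auto simp: chain_def\<close>)
      then show ?thesis by blast
    qed
  qed
  then obtain k J where "chain C k J" by blast
  then show thesis by (intro that[of J k]) (simp_all add: chain_def)
qed

section \<open>A quadratic form inequality for slice sizes\<close>

text \<open>The extremal normalised slices \<open>(x / g, y / g)\<close> are \<open>(1 / a, 1)\<close>, \<open>(2 / (a + 1), 2 / (a + 1))\<close>
  and \<open>(1, 1 / a)\<close>. The term in \<open>y - x\<close> has the smallest coefficient for which the bound holds when
  the first of these precedes the last; its sum over all pairs of slices is a square.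
  The remainders in the proof are the expansions over these three points.\<close>

lemma kernel_bound:
  fixes a :: real
  assumes a: "1 < a"
    and ratio: "y \<le> a * x" "x \<le> a * y" "y' \<le> a * x'" "x' \<le> a * y'"
    and g: "0 \<le> g" "2 * g \<le> a * x + y" "2 * g \<le> x + a * y"
    and g': "0 \<le> g'" "2 * g' \<le> a * x' + y'" "2 * g' \<le> x' + a * y'"
  shows "2 * (a - 1) * (g * g') + a * ((y - x) * (y' - x')) \<le> (a - 1) * a * (a + 1) * (x * y')"
proof -
  \<comment> \<open>The coefficient of \<open>g * g'\<close> is positive, so \<open>g\<close> and
    \<open>g'\<close> may be raised to \<open>u\<close> and \<open>u'\<close>; \<open>rest\<close>
    is the slack that remains.\<close>
  have red: ?thesis if "g \<le> u" "g' \<le> u'" "0 \<le> rest"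
      "2 * (a - 1) * (u * u') + a * ((y - x) * (y' - x')) + rest = (a - 1) * a * (a + 1) * (x * y')"
    for u u' rest
  proof -
    have "g * g' \<le> u * u'" using that g(1) g'(1) by (intro mult_mono) auto
    then have "2 * (a - 1) * (g * g') \<le> 2 * (a - 1) * (u * u')"
      using a by (intro mult_left_mono) auto
    then show ?thesis using that(3,4) by linarith
  qed
  \<comment> \<open>The sign of \<open>y - x\<close> decides which upper bound on
    \<open>2 * g\<close> is smaller: \<open>a * x + y\<close> if \<open>x \<le> y\<close>, else
    \<open>x + a * y\<close>. The same holds for \<open>g'\<close>.\<close>
  consider "x \<le> y" "x' \<le> y'" | "x \<le> y" "y' \<le> x'" | "y \<le> x" "x' \<le> y'" | "y \<le> x" "y' \<le> x'"
    by linarith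
  then show ?thesis
  proof cases
    case 1
    let ?p = "y - x" and ?q = "a * x - y" and ?p' = "y' - x'" and ?q' = "a * x' - y'"
    show ?thesis
    proof (rule red[of "(a * x + y) / 2" "(a * x' + y') / 2"])
      show "0 \<le> a * (a - 1) * ?p * ?p' + a * (a + 1) * ?q * ?p' + (a + 1) / 2 * ?q * ?q'"
        using a ratio 1 by (intro add_nonneg_nonneg mult_nonneg_nonneg) auto
    qed (use g g' in \<open>auto simp: field_simps power2_eq_square\<close>)
  next
    case 2
    let ?q = "a * x - y" and ?q' = "a * y' - x'"
    show ?thesis
    proof (rule red[of "(a * x + y) / 2" "(x' + a * y') / 2"])
      show "0 \<le> (a + 1) / 2 * ?q * ?q'"
        using a ratio 2 by (intro mult_nonneg_nonneg) auto
    qed (use g g' in \<open>auto simp: field_simps power2_eq_square\<close>)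
  next
    case 3
    let ?p = "x - y" and ?q = "a * y - x" and ?p' = "y' - x'" and ?q' = "a * x' - y'"
    show ?thesis
    proof (rule red[of "(x + a * y) / 2" "(a * x' + y') / 2"])
      show "0 \<le> a * (a + 1)\<^sup>2 * ?p * ?p' + a * (a + 1) * (?p * ?q' + ?q * ?p')
          + (a + 1) / 2 * ?q * ?q'"
        using a ratio 3 by (intro add_nonneg_nonneg mult_nonneg_nonneg) auto
    qed (use g g' in \<open>auto simp: field_simps power2_eq_square\<close>)
  next
    case 4
    let ?p = "x - y" and ?q = "a * y - x" and ?p' = "x' - y'" and ?q' = "a * y' - x'"
    show ?thesis
    proof (rule red[of "(x + a * y) / 2" "(x' + a * y') / 2"])
      show "0 \<le> a * (a - 1) * ?p * ?p' + a * (a + 1) * ?p * ?q' + (a + 1) / 2 * ?q * ?q'"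
        using a ratio 4 by (intro add_nonneg_nonneg mult_nonneg_nonneg) auto
    qed (use g g' in \<open>auto simp: field_simps power2_eq_square\<close>)
  qed
qed

text \<open>By symmetry the full sum of \<open>S\<close> is twice its sum over
  \<open>s \<le> t\<close> minus the diagonal, which is nonnegative.\<close>

lemma double_sum_le_triangle:
  fixes S T :: "nat \<Rightarrow> nat \<Rightarrow> real"
  assumes "\<And>s t. S s t = S t s" "\<And>s. s < k \<Longrightarrow> 0 \<le> S s s"
    and "\<And>s t. s \<le> t \<Longrightarrow> t < k \<Longrightarrow> S s t \<le> T s t"
  shows "(\<Sum>s<k. \<Sum>t<k. S s t) \<le> 2 * (\<Sum>t<k. \<Sum>s\<le>t. T s t)"
  using assms(2,3)
proof (induction k)
  case (Suc k)
  have "(\<Sum>s<k. S k s) = (\<Sum>s<k. S s k)" by (intro sum.cong assms(1)) auto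
  then have "(\<Sum>s<Suc k. \<Sum>t<Suc k. S s t) = (\<Sum>s<k. \<Sum>t<k. S s t) + 2 * (\<Sum>s<k. S s k) + S k k"
    by (simp add: sum.distrib)
  also have "\<dots> \<le> (\<Sum>s<k. \<Sum>t<k. S s t) + 2 * (\<Sum>s\<le>k. S s k)"
    using Suc.prems(1)[of k] by (simp add: lessThan_Suc_atMost[symmetric])
  also have "(\<Sum>s\<le>k. S s k) \<le> (\<Sum>s\<le>k. T s k)"
    using Suc.prems(2) by (intro sum_mono) auto
  finally show ?case using Suc by simp
qed simp

text \<open>Summing \<open>kernel_bound\<close> over \<open>s \<le> t\<close> turns both products on
  its left into squares of sums; the square coming from \<open>y s - x s\<close> is dropped and
  \<open>2 * (a - 1)\<close> cancels.\<close>

lemma square_sum_le_triangle: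
  fixes a :: real and x y g :: "nat \<Rightarrow> real"
  assumes a: "1 \<le> a"
    and ratio: "\<And>s. s < k \<Longrightarrow> y s \<le> a * x s" "\<And>s. s < k \<Longrightarrow> x s \<le> a * y s"
    and g: "\<And>s. s < k \<Longrightarrow> 0 \<le> g s" "\<And>s. s < k \<Longrightarrow> 2 * g s \<le> a * x s + y s"
      "\<And>s. s < k \<Longrightarrow> 2 * g s \<le> x s + a * y s"
  shows "(\<Sum>s<k. g s)\<^sup>2 \<le> a * (a + 1) * (\<Sum>t<k. \<Sum>s\<le>t. x s * y t)"
proof (cases "a = 1")
  \<comment> \<open>At \<open>a = 1\<close> the factor \<open>a - 1\<close> makes the kernel
    inequality empty, but here \<open>x s = y s\<close> and \<open>g s \<le> x s\<close>, so terms
    compare directly.\<close>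
  case True
  have "(\<Sum>s<k. \<Sum>t<k. g s * g t) \<le> 2 * (\<Sum>t<k. \<Sum>s\<le>t. x s * y t)"
  proof (rule double_sum_le_triangle)
    fix s t assume "s \<le> t" "t < k"
    then have "g s \<le> x s" "g t \<le> y t" "0 \<le> g s" "0 \<le> g t"
      using ratio[of s] ratio[of t] g[of s] g[of t] True by auto
    then show "g s * g t \<le> x s * y t" by (intro mult_mono) auto
  qed (use g(1) in auto)
  then show ?thesis
    by (simp add: True power2_eq_square sum_product)
next
  case False
  then have "1 < a" using a by simp
  define S where "S s t = 2 * (a - 1) * (g s * g t) + a * ((y s - x s) * (y t - x t))" for s t
  have "(\<Sum>s<k. \<Sum>t<k. S s t) \<le> 2 * (\<Sum>t<k. \<Sum>s\<le>t. (a - 1) * a * (a + 1) * (x s * y t))"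
  proof (rule double_sum_le_triangle)
    show "S s t \<le> (a - 1) * a * (a + 1) * (x s * y t)" if "s \<le> t" "t < k" for s t
      unfolding S_def using \<open>1 < a\<close> that by (intro kernel_bound ratio g) auto
  qed (use \<open>1 < a\<close> in \<open>auto simp: S_def\<close>)
  also have "\<dots> = 2 * (a - 1) * (a * (a + 1) * (\<Sum>t<k. \<Sum>s\<le>t. x s * y t))"
    by (simp add: sum_distrib_left[symmetric])
  finally have "(\<Sum>s<k. \<Sum>t<k. S s t) \<le> \<dots>" .
  moreover have "(\<Sum>s<k. \<Sum>t<k. S s t) = 2 * (a - 1) * (\<Sum>s<k. g s)\<^sup>2 + a * (\<Sum>s<k. y s - x s)\<^sup>2"
    unfolding S_def power2_eq_square sum_product by (simp add: sum.distrib sum_distrib_left)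
  moreover have "0 \<le> a * (\<Sum>s<k. y s - x s)\<^sup>2" using a by simp
  ultimately have "2 * (a - 1) * (\<Sum>s<k. g s)\<^sup>2 \<le> 2 * (a - 1) * (a * (a + 1) * (\<Sum>t<k. \<Sum>s\<le>t. x s * y t))"
    by linarith
  then show ?thesis using \<open>1 < a\<close> by simp
qed

section \<open>Solving the quadratic inequality\<close>

text \<open>Completing the square gives \<open>2 * n / sqrt a \<le> \<beta> + sqrt (4 * (a + 1) * p
  + \<beta>\<^sup>2)\<close>; the stated bound only adds nonnegative terms to this.\<close>

lemma final_estimate:
  fixes a n p \<beta> :: real
  assumes "1 \<le> a" "0 \<le> n" "0 \<le> p" and n: "n\<^sup>2 \<le> a * (a + 1) * (n + p)"
    and \<beta>: "\<beta> = sqrt a * (a + 1)"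
  shows "n \<le> sqrt (a / 4 * (\<beta> + sqrt (\<beta> * (a - 1) + 4 * (a + 1) * p + \<beta>\<^sup>2) + (a - 1) / 2)\<^sup>2
      - (a - 1)\<^sup>2 * a / 16)"
proof -
  define s X where "s = sqrt a" and "X = \<beta> + sqrt (\<beta> * (a - 1) + 4 * (a + 1) * p + \<beta>\<^sup>2)"
  have s: "s > 0" "a = s\<^sup>2" using assms(1) by (auto simp: s_def)
  have "\<beta> \<ge> 0" using assms by simp
  have "(2 * n / s - \<beta>)\<^sup>2 = 4 * n\<^sup>2 / a - 4 * (a + 1) * n + \<beta>\<^sup>2"
    unfolding \<beta> s_def[symmetric] using s by (simp add: power2_eq_square field_simps)
  also have "\<dots> \<le> 4 * (a + 1) * p + \<beta>\<^sup>2"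
    using n assms(1) by (simp add: field_simps)
  also have "\<dots> \<le> \<beta> * (a - 1) + 4 * (a + 1) * p + \<beta>\<^sup>2"
    using \<open>\<beta> \<ge> 0\<close> assms(1) by simp
  finally have "2 * n / s \<le> X"
    unfolding X_def using real_le_rsqrt[of "2 * n / s - \<beta>"] by fastforce
  then have "(2 * n / s)\<^sup>2 \<le> X\<^sup>2" and X: "X \<ge> 0"
    using s assms(2) by (auto intro!: power_mono intro: order_trans[rotated])
  then have "4 * n\<^sup>2 \<le> a * X\<^sup>2"
    using s by (simp add: power_divide power_mult_distrib field_simps)
  \<comment> \<open>Expanding the square in the goal cancels \<open>(a - 1)\<^sup>2 * a / 16\<close>
    and leaves \<open>a / 4 * X\<^sup>2\<close> plus a quarter of this term.\<close>
  moreover have "0 \<le> a * ((a - 1) * X)" using assms(1) X by simp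
  ultimately have "n\<^sup>2 \<le> a / 4 * (X + (a - 1) / 2)\<^sup>2 - (a - 1)\<^sup>2 * a / 16"
    by (simp add: power2_eq_square field_simps)
  then show ?thesis unfolding X_def by (rule real_le_rsqrt)
qed

section \<open>Slicing \<open>F\<close> and counting the points of \<open>D\<close>\<close>

lemma card_diff_square_le:
  assumes fin: "finite F" "finite G" and uniq: "uniquely_determined F"
    and card_eq: "card F = card G" and err: "2 * int \<alpha> = line_sum_error F G"
  shows "(real (card (F - G)))\<^sup>2 \<le> real \<alpha> * (real \<alpha> + 1) * real (card F)"
proof -
  define D R where "D = F - G" and "R i = F `` {i}" for i
  have finD: "finite D" using fin by (simp add: D_def)
  have finR: "finite (R i)" for i
    by (rule finite_subset[of _ "snd ` F"]) (use fin in \<open>force simp: R_def\<close>)+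
  have nested: "R i \<subseteq> R i' \<or> R i' \<subseteq> R i" for i i'
    unfolding R_def by (rule uniquely_determined_nested[OF fin(1) uniq])
  obtain k J where J0: "J 0 = {}" and strict: "\<And>s. s < k \<Longrightarrow> J s \<subset> J (Suc s)"
      and JR: "\<And>s. s < k \<Longrightarrow> \<exists>i. J (Suc s) = R i"
      and least: "\<And>s i j. s < k \<Longrightarrow> (i, j) \<in> D \<Longrightarrow> j \<notin> J s \<Longrightarrow> J (Suc s) \<subseteq> R i"
      and total: "\<And>i j. (i, j) \<in> D \<Longrightarrow> j \<in> J k"
    by (rule greedy_chain[where C = "{}", OF finD finR nested]) (auto simp: D_def R_def)
  have J_mono: "J s \<subseteq> J t" if "s \<le> t" "t \<le> k" for s t
    using that
  proof (induction t rule: dec_induct)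
    case (step t)
    then show ?case using strict[of t] by auto
  qed simp
  have finJ: "finite (J s)" if "s \<le> k" for s
    using that JR[of "s - 1"] finR J0 by (cases s) auto
  define X where "X s = J (Suc s) - J s" for s
  \<comment> \<open>The conjunct \<open>s < k\<close> makes \<open>U k\<close> empty, so the last
    row slice is all of \<open>U (k - 1)\<close>.\<close>
  define U where "U s = {i. s < k \<and> J (Suc s) \<subseteq> R i}" for s
  define Y where "Y s = U s - U (Suc s)" for s
  define n where "n s = card (D \<inter> UNIV \<times> X s)" for s
  define m where "m s = card (D \<inter> Y s \<times> X s)" for s
  have in_U: "i \<in> U s" if "(i, j) \<in> D" "j \<in> X s" "s < k" for i j s
    using least[of s i j] that by (auto simp: U_def X_def)
  have U_mono: "U t \<subseteq> U s" if "s \<le> t" for s t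
    using J_mono[of "Suc s" "Suc t"] that unfolding U_def by fastforce
  have cut: "card (D \<inter> U s \<times> J (Suc s)) \<le> \<alpha>" if "s < k" for s
    unfolding D_def
  proof (rule card_diff_in_rectangle_le[OF fin card_eq err])
    show "U s \<times> J (Suc s) \<subseteq> F" by (auto simp: U_def R_def)
    \<comment> \<open>A row outside \<open>U s\<close> does not contain the row
      \<open>J (Suc s)\<close>, so by nestedness it lies inside it.\<close>
    from JR[OF that] obtain i where i: "J (Suc s) = R i" by blast
    show "F \<inter> (- U s) \<times> (- J (Suc s)) = {}"
    proof (safe, goal_cases)
      case (1 i' j')
      then show ?case using nested[of i i'] that unfolding U_def R_def i by auto
    qed
  qed
  have n_le: "n s \<le> \<alpha>" if "s < k" for s
  proof -
    have "D \<inter> UNIV \<times> X s \<subseteq> D \<inter> U s \<times> J (Suc s)" using in_U that by (auto simp: X_def)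
    then show ?thesis
      using cut[OF that] card_mono[of "D \<inter> U s \<times> J (Suc s)" "D \<inter> UNIV \<times> X s"] finD
      by (auto simp: n_def)
  qed
  have n_split: "n s = m s + card (D \<inter> U (Suc s) \<times> X s)" if "s < k" for s
  proof -
    have "D \<inter> UNIV \<times> X s = (D \<inter> Y s \<times> X s) \<union> (D \<inter> U (Suc s) \<times> X s)"
      using in_U that by (auto simp: Y_def)
    moreover have "(D \<inter> Y s \<times> X s) \<inter> (D \<inter> U (Suc s) \<times> X s) = {}"
      by (auto simp: Y_def)
    ultimately show ?thesis using finD by (simp add: n_def m_def card_Un_disjoint)
  qed
  have n_last: "n s = m s" if "Suc s = k" for s
    using n_split[of s] that by (auto simp: U_def)
  \<comment> \<open>The points of slice \<open>s\<close> off its diagonal block and all points of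
    slice \<open>Suc s\<close> lie in the one rectangle
    \<open>U (Suc s) \<times> J (Suc (Suc s))\<close>.\<close>
  have n_pair: "n s + n (Suc s) \<le> \<alpha> + m s" if "Suc s < k" for s
  proof -
    have "card (D \<inter> U (Suc s) \<times> X s) + n (Suc s)
        = card ((D \<inter> U (Suc s) \<times> X s) \<union> (D \<inter> UNIV \<times> X (Suc s)))"
      unfolding n_def using finD by (subst card_Un_disjoint) (auto simp: X_def)
    also have "\<dots> \<le> card (D \<inter> U (Suc s) \<times> J (Suc (Suc s)))"
      using finD that in_U[of _ _ "Suc s"] strict[of "Suc s"]
      by (intro card_mono) (auto simp: X_def)
    also have "\<dots> \<le> \<alpha>" using cut that by simp
    finally show ?thesis using n_split[of s] that by simp
  qed
  \<comment> \<open>This adds \<open>n 0 \<le> \<alpha>\<close> to the inequalities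
    \<open>n_pair\<close>, which count every slice but the first and last twice;
    \<open>n_last\<close> then completes the count at \<open>l = k - 1\<close>.\<close>
  have "2 * (\<Sum>s<l. n s) + n l \<le> \<alpha> + (\<Sum>s<l. \<alpha> + m s)" if "Suc l \<le> k" for l
    using that
  proof (induction l)
    case 0
    then show ?case using n_le[of 0] by simp
  next
    case (Suc l)
    then show ?case using n_pair[of l] by simp
  qed
  then have sum_n: "2 * (\<Sum>s<k. n s) \<le> (\<Sum>s<k. \<alpha> + m s)"
    using n_last by (cases k) fastforce+
  have "card D = (\<Sum>s<k. n s)"
  proof -
    have "card (D \<inter> UNIV \<times> J l) = (\<Sum>s<l. n s)" if "l \<le> k" for l
      using that
    proof (induction l)
      case (Suc l)
      have "D \<inter> UNIV \<times> J (Suc l) = (D \<inter> UNIV \<times> J l) \<union> (D \<inter> UNIV \<times> X l)"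
        using strict[of l] Suc.prems by (auto simp: X_def)
      moreover have "(D \<inter> UNIV \<times> J l) \<inter> (D \<inter> UNIV \<times> X l) = {}" by (auto simp: X_def)
      ultimately have "card (D \<inter> UNIV \<times> J (Suc l)) = card (D \<inter> UNIV \<times> J l) + n l"
        using finD by (simp add: card_Un_disjoint n_def)
      then show ?case using Suc by simp
    qed (simp add: J0)
    moreover have "D \<inter> UNIV \<times> J k = D" using total by auto
    ultimately show ?thesis by (metis order_refl)
  qed
  with sum_n have D_le: "2 * card D \<le> (\<Sum>s<k. \<alpha> + m s)" by simp
  have finX: "finite (X s)" and X_ne: "X s \<noteq> {}" if "s < k" for s
    using strict[OF that] finJ[of "Suc s"] that by (auto simp: X_def)
  have finU: "finite (U s)" for s
  proof (cases "s < k")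
    case True
    then obtain j where "j \<in> J (Suc s)" using strict by blast
    then have "U s \<subseteq> fst ` F" by (force simp: U_def R_def)
    then show ?thesis using fin finite_subset by auto
  qed (auto simp: U_def)
  then have finY: "finite (Y s)" for s by (simp add: Y_def)
  have Y_ne: "Y s \<noteq> {}" if "s < k" for s
  proof -
    from JR[OF that] obtain i where "J (Suc s) = R i" by blast
    \<comment> \<open>The row equal to \<open>J (Suc s)\<close> cannot contain the strictly larger
      next set.\<close>
    then have "i \<in> Y s" using that strict[of "Suc s"] by (auto simp: Y_def U_def)
    then show ?thesis by blast
  qed
  \<comment> \<open>The blocks \<open>Y t \<times> J (Suc t)\<close> are disjoint subsets of
    \<open>F\<close>.\<close>
  have triangle: "(\<Sum>t<k. \<Sum>s\<le>t. card (X s) * card (Y t)) \<le> card F"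
  proof -
    have card_J: "card (J (Suc t)) = (\<Sum>s\<le>t. card (X s))" if "t < k" for t
      using that
    proof (induction t)
      case 0
      then show ?case by (simp add: X_def J0)
    next
      case (Suc t)
      have "card (J (Suc (Suc t))) = card (J (Suc t)) + card (X (Suc t))"
        using card_Int_Diff[OF finJ, of "Suc (Suc t)" "J (Suc t)"] strict[of "Suc t"] Suc.prems
        by (auto simp: X_def Int_absorb1 psubset_imp_subset)
      then show ?case using Suc by simp
    qed
    have "(\<Sum>t<k. \<Sum>s\<le>t. card (X s) * card (Y t)) = (\<Sum>t<k. card (Y t \<times> J (Suc t)))"
      by (intro sum.cong) (auto simp: card_J sum_distrib_left mult.commute card_cartesian_product)
    also have "\<dots> = card (\<Union>t<k. Y t \<times> J (Suc t))"
    proof (rule card_UN_disjoint[symmetric])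
      show "\<forall>t\<in>{..<k}. finite (Y t \<times> J (Suc t))" using finY finJ by auto
      have "Y s \<inter> Y t = {}" if "s < t" for s t
        using U_mono[of "Suc s" t] that by (auto simp: Y_def)
      then show "\<forall>s\<in>{..<k}. \<forall>t\<in>{..<k}. s \<noteq> t \<longrightarrow>
          (Y s \<times> J (Suc s)) \<inter> (Y t \<times> J (Suc t)) = {}"
        by (metis Int_commute Sigma_empty1 Times_Int_Times linorder_neqE_nat)
    qed auto
    also have "\<dots> \<le> card F"
      using fin by (intro card_mono) (auto simp: Y_def U_def R_def)
    finally show ?thesis .
  qed
  show ?thesis
  proof (cases "\<alpha> = 0 \<or> k = 0")
    case True
    then have "card D = 0"
      using n_le \<open>card D = (\<Sum>s<k. n s)\<close> by auto
    then show ?thesis unfolding D_def by simp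
  next
    case False
    then have "1 \<le> \<alpha>" by simp
    \<comment> \<open>Truncation at \<open>\<alpha>\<close> keeps the ratios of \<open>x s\<close>
      and \<open>y s\<close> between \<open>1 / \<alpha>\<close> and \<open>\<alpha>\<close> and
      only shrinks the triangular sum. The bound \<open>m s \<le> x s * y s\<close> survives since
      \<open>m s \<le> \<alpha>\<close>.\<close>
    define x y where "x s = min \<alpha> (card (X s))" and "y s = min \<alpha> (card (Y s))" for s
    have xy: "1 \<le> x s" "x s \<le> \<alpha>" "1 \<le> y s" "y s \<le> \<alpha>" if "s < k" for s
      using finX[OF that] X_ne[OF that] finY[of s] Y_ne[OF that] \<open>1 \<le> \<alpha>\<close>
      by (auto simp: x_def y_def card_gt_0_iff Suc_le_eq)
    have m_le: "m s \<le> \<alpha>" if "s < k" for s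
      using n_le[OF that] n_split[OF that] by simp
    have m_le_xy: "m s \<le> x s * y s" if "s < k" for s
    proof -
      have "m s \<le> card (Y s \<times> X s)"
        unfolding m_def using finY finX that by (intro card_mono) auto
      then have "m s \<le> card (X s) * card (Y s)" by (simp add: card_cartesian_product mult.commute)
      moreover have "x s = \<alpha> \<or> y s = \<alpha> \<or> x s = card (X s) \<and> y s = card (Y s)"
        by (auto simp: x_def y_def min_def)
      moreover have "\<alpha> \<le> \<alpha> * y s" "\<alpha> \<le> x s * \<alpha>" using xy[OF that] by simp_all
      ultimately show ?thesis using m_le[OF that] by (metis order_trans)
    qed
    \<comment> \<open>Used in both orders of \<open>x s\<close> and \<open>y s\<close>, this bounds
      \<open>g = (\<alpha> + m s) / 2\<close>. For \<open>u = 1\<close> it is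
      \<open>q \<le> v\<close>; for \<open>u \<ge> 2\<close> already \<open>\<alpha> * u\<close>
      suffices.\<close>
    have lin: "\<alpha> + q \<le> \<alpha> * u + v" if "q \<le> \<alpha>" "q \<le> u * v" "1 \<le> u" for q u v
    proof (cases "u = 1")
      case False
      then have "\<alpha> * 2 \<le> \<alpha> * u" using that by (intro mult_le_mono2) auto
      then show ?thesis using that by linarith
    qed (use that in simp)
    have "(\<Sum>s<k. (real \<alpha> + m s) / 2)\<^sup>2
        \<le> real \<alpha> * (real \<alpha> + 1) * (\<Sum>t<k. \<Sum>s\<le>t. real (x s) * real (y t))"
    proof (rule square_sum_le_triangle)
      fix s assume s: "s < k"
      have "y s \<le> \<alpha> * x s" "x s \<le> \<alpha> * y s"
        using mult_le_mono[OF xy(4)[OF s] xy(1)[OF s]] mult_le_mono[OF xy(2)[OF s] xy(3)[OF s]]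
        by simp_all
      then show "real (y s) \<le> real \<alpha> * real (x s)" "real (x s) \<le> real \<alpha> * real (y s)"
        by (simp_all flip: of_nat_mult)
      have "\<alpha> + m s \<le> \<alpha> * x s + y s" "\<alpha> + m s \<le> x s + \<alpha> * y s"
        using lin[of "m s" "x s" "y s"] lin[of "m s" "y s" "x s"] m_le[OF s] m_le_xy[OF s] xy[OF s]
        by (simp_all add: mult.commute)
      then show "2 * ((real \<alpha> + m s) / 2) \<le> real \<alpha> * real (x s) + real (y s)"
          "2 * ((real \<alpha> + m s) / 2) \<le> real (x s) + real \<alpha> * real (y s)"
        by (simp_all flip: of_nat_mult of_nat_add)
    qed (use \<open>1 \<le> \<alpha>\<close> in auto)
    moreover have "real (card D) \<le> (\<Sum>s<k. (real \<alpha> + m s) / 2)"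
    proof -
      have "2 * real (card D) \<le> (\<Sum>s<k. real \<alpha> + m s)"
        using D_le by (simp flip: of_nat_sum of_nat_add of_nat_mult)
      then show ?thesis by (simp flip: sum_divide_distrib)
    qed
    then have "(real (card D))\<^sup>2 \<le> (\<Sum>s<k. (real \<alpha> + m s) / 2)\<^sup>2"
      by (intro power_mono) auto
    moreover have "(\<Sum>t<k. \<Sum>s\<le>t. real (x s) * real (y t)) \<le> real (card F)"
    proof -
      have "(\<Sum>t<k. \<Sum>s\<le>t. x s * y t) \<le> (\<Sum>t<k. \<Sum>s\<le>t. card (X s) * card (Y t))"
        by (intro sum_mono mult_le_mono) (auto simp: x_def y_def)
      also note triangle
      finally show ?thesis by (simp flip: of_nat_sum of_nat_mult)
    qed
    then have "real \<alpha> * (real \<alpha> + 1) * (\<Sum>t<k. \<Sum>s\<le>t. real (x s) * real (y t))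
        \<le> real \<alpha> * (real \<alpha> + 1) * real (card F)"
      by (intro mult_left_mono) auto
    ultimately show ?thesis unfolding D_def by linarith
  qed
qed

theorem theorem12:
  fixes F\<^sub>1 F\<^sub>2 :: "(int \<times> int) set" and \<alpha> p :: nat and \<beta> :: real
  assumes "finite F\<^sub>1" and "finite F\<^sub>2"
    and "uniquely_determined F\<^sub>1"
    and "card F\<^sub>1 = card F\<^sub>2"
    and "2 * int \<alpha> = line_sum_error F\<^sub>1 F\<^sub>2"
    and "p = card (F\<^sub>1 \<inter> F\<^sub>2)"
    and "\<beta> = sqrt (real \<alpha>) * (real \<alpha> + 1)"
  shows "real (card F\<^sub>1) \<le> real p +
    sqrt (real \<alpha> / 4 *
        (\<beta> + sqrt (\<beta> * (real \<alpha> - 1) + 4 * (real \<alpha> + 1) * real p + \<beta>\<^sup>2)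
          + (real \<alpha> - 1) / 2)\<^sup>2
      - (real \<alpha> - 1)\<^sup>2 * real \<alpha> / 16)"
proof -
  let ?n = "card (F\<^sub>1 - F\<^sub>2)"
  have card: "card F\<^sub>1 = ?n + p"
    using assms(1,6) by (metis add.commute card_Int_Diff)
  have bound: "(real ?n)\<^sup>2 \<le> real \<alpha> * (real \<alpha> + 1) * (real ?n + real p)"
    using card_diff_square_le[OF assms(1-5)] card by simp
  show ?thesis
  \<comment> \<open>For \<open>\<alpha> = 0\<close> the bound forces \<open>?n = 0\<close>, and both
    sides of the claim equal \<open>p\<close>.\<close>
  proof (cases "\<alpha> = 0")
    case True
    then show ?thesis using bound card by simp
  next
    case False
    then have "1 \<le> real \<alpha>" by simp
    from final_estimate[OF this _ _ bound assms(7)] show ?thesis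
      using card by simp
  qed
qed

end
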